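(* Let $r>u\ge 2$ be integers and let $F$ be a graph with $v(F)>2$, $e(F)>\frac{r-1}{2}v(F)+\binom{r}{2}-(r-1)$, and $$\max_{F_0\subseteq F,\ e(F_0)>0}\frac{2e(F_0)}{v(F_0)}<\frac{2e(F)-r(r-1)}{v(F)-2}.$$ Then there is a constant $C_{u,r}>0$ depending on $F$, $u$ and $r$ such that for all sufficiently large $t$, $$\mathrm{ex}_u(t,K_r,F)\ge C_{u,r}\, t^{\frac{re(F)-\binom r2 v(F)-r\binom r2+2\binom r2}{ue(F)-\binom u2 v(F)-u\binom r2+2\binom u2}}.$$
   Context: All graphs are finite and simple; $v(H)$ and $e(H)$ denote the numbers of vertices and edges of $H$, and the maximum is over subgraphs $F_0$ of $F$ with at least one edge. $\mathrm{ex}_u(t,K_r,F)$ is the maximum number of copies of $K_r$ in an $F$-free graph containing exactly $t$ copies of $K_u$. *)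

theory Defs
  imports Complex_Main "HOL-Library.Ramsey"
begin

datatype 'a ugraph = UGraph (verts: "'a set") (edges: "'a set set")

definition simple_graph :: "'a ugraph \<Rightarrow> bool" where
  "simple_graph G \<longleftrightarrow> finite (verts G) \<and> edges G \<subseteq> [verts G]\<^bsup>2\<^esup>"

definition num_verts :: "'a ugraph \<Rightarrow> nat" where
  "num_verts G = card (verts G)"

definition num_edges :: "'a ugraph \<Rightarrow> nat" where
  "num_edges G = card (edges G)"

definition subgraph :: "'a ugraph \<Rightarrow> 'a ugraph \<Rightarrow> bool" where
  "subgraph H G \<longleftrightarrow> simple_graph H \<and> verts H \<subseteq> verts G \<and> edges H \<subseteq> edges G"

definition isomorphic :: "'a ugraph \<Rightarrow> 'b ugraph \<Rightarrow> bool" where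
  "isomorphic G H \<longleftrightarrow>
    (\<exists>f. bij_betw f (verts G) (verts H) \<and> (\<lambda>e. f ` e) ` edges G = edges H)"

definition complete_graph :: "nat \<Rightarrow> nat ugraph" where
  "complete_graph r = UGraph {..<r} ([{..<r}]\<^bsup>2\<^esup>)"

definition copies :: "'a ugraph \<Rightarrow> 'b ugraph \<Rightarrow> 'b ugraph set" where
  "copies H G = {H'. subgraph H' G \<and> isomorphic H H'}"

definition graph_free :: "'a ugraph \<Rightarrow> 'b ugraph \<Rightarrow> bool" where
  "graph_free F G \<longleftrightarrow> copies F G = {}"

text \<open>
  Host graphs have natural numbers as vertices, which is no restriction for finite graphs.
  Their number of vertices is not bounded, but for \<open>H\<close> the complete graph on \<open>r\<close> vertices
  with \<open>r \<ge> u \<ge> 1\<close> the values form a finite set, because a copy of \<open>H\<close> is determined by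
  the copies of the complete graph on \<open>u\<close> vertices that it contains.
\<close>

definition ex_u :: "nat \<Rightarrow> nat \<Rightarrow> 'a ugraph \<Rightarrow> 'b ugraph \<Rightarrow> nat" where
  "ex_u u t H F = Max {card (copies H G) | G :: nat ugraph.
     simple_graph G \<and> graph_free F G \<and> card (copies (complete_graph u) G) = t}"

end

theory Submission
  imports Defs
begin

text \<open>
  Write \<open>v\<close> and \<open>e\<close> for the numbers of vertices and edges of \<open>F\<close>, and let
  \<open>a = (v - 2) / (e - (r choose 2))\<close>. In a random graph on \<open>n\<close> vertices with edge probability
  \<open>p = c n\<^sup>-\<^sup>a\<close>, the expected number of copies of \<open>F\<close> is at most a small multiple of
  \<open>n\<^sup>2 p ^ (r choose 2)\<close>. An edge lies in at most \<open>n ^ (r - 2)\<close> copies of the complete graph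
  \<open>K\<^sub>r\<close>, so deleting one edge from every copy of \<open>F\<close> keeps a constant fraction of the
  \<open>n ^ r p ^ (r choose 2)\<close> copies of \<open>K\<^sub>r\<close>, while there are only \<open>O(n ^ u p ^ (u choose 2))\<close>
  copies of \<open>K\<^sub>u\<close>. Disjoint copies of \<open>K\<^sub>u\<close> are then added to reach exactly \<open>t\<close> of them. If this
  created a copy of \<open>F\<close>, its part in the added cliques would be so sparse that the remaining
  part \<open>F\<^sub>0\<close> would violate \<open>a e(F\<^sub>0) \<le> v(F\<^sub>0)\<close>, which is what the maximum density
  hypothesis provides. Isolated vertices of \<open>F\<close> are ignored throughout: the deletion destroys
  every embedding of the edges of \<open>F\<close>.
\<close>

section \<open>Cliques as vertex sets, and copies of complete graphs\<close>

text \<open>A copy of a complete graph is determined by its vertex set, so copies can be counted as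
  sets of \<open>k\<close> vertices.\<close>

definition cliques :: "nat \<Rightarrow> 'a set \<Rightarrow> 'a set set \<Rightarrow> 'a set set" where
  "cliques k V E = {S. S \<subseteq> V \<and> card S = k \<and> [S]\<^bsup>2\<^esup> \<subseteq> E}"

lemma finite_cliques: "finite V \<Longrightarrow> finite (cliques k V E)"
  unfolding cliques_def by (rule finite_subset[of _ "Pow V"]) auto

lemma cliques_mono: "V \<subseteq> V' \<Longrightarrow> E \<subseteq> E' \<Longrightarrow> cliques k V E \<subseteq> cliques k V' E'"
  unfolding cliques_def by auto

text \<open>A clique meeting both sides would need a crossing edge, and there is none. The bound
  \<open>2 \<le> k\<close> keeps the empty set from being a clique of both sides.\<close>

lemma cliques_disjoint_union:
  assumes "2 \<le> k" "A \<inter> B = {}" "E1 \<subseteq> [A]\<^bsup>2\<^esup>" "E2 \<subseteq> [B]\<^bsup>2\<^esup>"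
  shows "cliques k (A \<union> B) (E1 \<union> E2) = cliques k A E1 \<union> cliques k B E2"
    and "cliques k A E1 \<inter> cliques k B E2 = {}"
proof -
  show "cliques k A E1 \<inter> cliques k B E2 = {}"
  proof (rule ccontr)
    assume "\<not> ?thesis"
    then obtain S where "S \<subseteq> A" "S \<subseteq> B" "card S = k" by (auto simp: cliques_def)
    then have "S = {}" using assms(2) by blast
    then show False using \<open>card S = k\<close> assms(1) by simp
  qed
  have "S \<in> cliques k A E1 \<union> cliques k B E2" if S: "S \<in> cliques k (A \<union> B) (E1 \<union> E2)" for S
  proof (cases "S \<inter> A = {}")
    case True
    then have "S \<subseteq> B" using S by (auto simp: cliques_def)
    moreover have "[S]\<^bsup>2\<^esup> \<subseteq> E2"
    proof
      fix e assume e: "e \<in> [S]\<^bsup>2\<^esup>"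
      then have "e \<noteq> {}" "e \<subseteq> S" by (auto simp: nsets_def)
      then have "e \<notin> E1" using assms(3) True by (auto simp: nsets_def)
      then show "e \<in> E2" using e S by (auto simp: cliques_def)
    qed
    ultimately show ?thesis using S by (auto simp: cliques_def)
  next
    case False
    then obtain x where x: "x \<in> S" "x \<in> A" by auto
    have SA: "S \<subseteq> A"
    proof
      fix y assume y: "y \<in> S"
      show "y \<in> A"
      proof (cases "y = x")
        case False
        then have "{x, y} \<in> [S]\<^bsup>2\<^esup>" using x y by simp
        then have "{x, y} \<in> E1 \<union> E2" using S unfolding cliques_def by blast
        moreover have "{x, y} \<notin> E2" using x assms(2,4) by (auto simp: nsets_def)
        ultimately show ?thesis using assms(3) by (auto simp: nsets_def)
      qed (use x in auto)
    qed
    moreover have "[S]\<^bsup>2\<^esup> \<subseteq> E1"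
    proof
      fix e assume e: "e \<in> [S]\<^bsup>2\<^esup>"
      then have "e \<noteq> {}" "e \<subseteq> A" using SA by (auto simp: nsets_def)
      then have "e \<notin> E2" using assms(2,4) by (auto simp: nsets_def)
      then show "e \<in> E1" using e S by (auto simp: cliques_def)
    qed
    ultimately show ?thesis using S by (auto simp: cliques_def)
  qed
  moreover have "cliques k A E1 \<union> cliques k B E2 \<subseteq> cliques k (A \<union> B) (E1 \<union> E2)"
    by (auto simp: cliques_def)
  ultimately show "cliques k (A \<union> B) (E1 \<union> E2) = cliques k A E1 \<union> cliques k B E2"
    by blast
qed

lemma card_cliques_disjoint_union:
  assumes "2 \<le> k" "A \<inter> B = {}" "E1 \<subseteq> [A]\<^bsup>2\<^esup>" "E2 \<subseteq> [B]\<^bsup>2\<^esup>" "finite A" "finite B"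
  shows "card (cliques k (A \<union> B) (E1 \<union> E2)) = card (cliques k A E1) + card (cliques k B E2)"
  using cliques_disjoint_union[OF assms(1-4)] assms(5,6)
  by (simp add: card_Un_disjoint finite_cliques)

lemma isomorphic_complete_graph_iff:
  "isomorphic (complete_graph k) H \<and> simple_graph H \<longleftrightarrow>
     finite (verts H) \<and> card (verts H) = k \<and> edges H = [verts H]\<^bsup>2\<^esup>"
proof
  assume "isomorphic (complete_graph k) H \<and> simple_graph H"
  then obtain f where f: "bij_betw f {..<k} (verts H)" "(\<lambda>e. f ` e) ` [{..<k}]\<^bsup>2\<^esup> = edges H"
    and fin: "finite (verts H)"
    by (auto simp: isomorphic_def complete_graph_def simple_graph_def)
  have "card (verts H) = k" using bij_betw_same_card[OF f(1)] by simp
  moreover have "(\<lambda>e. f ` e) ` [{..<k}]\<^bsup>2\<^esup> = [verts H]\<^bsup>2\<^esup>"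
    using bij_betw_nsets[OF f(1), of 2] by (simp add: bij_betw_def)
  ultimately show "finite (verts H) \<and> card (verts H) = k \<and> edges H = [verts H]\<^bsup>2\<^esup>"
    using f fin by simp
next
  assume H: "finite (verts H) \<and> card (verts H) = k \<and> edges H = [verts H]\<^bsup>2\<^esup>"
  then obtain f where f: "bij_betw f {..<k} (verts H)"
    using finite_same_card_bij[of "{..<k}" "verts H"] by auto
  have "(\<lambda>e. f ` e) ` [{..<k}]\<^bsup>2\<^esup> = [verts H]\<^bsup>2\<^esup>"
    using bij_betw_nsets[OF f(1), of 2] by (simp add: bij_betw_def)
  then show "isomorphic (complete_graph k) H \<and> simple_graph H"
    using f H by (auto simp: isomorphic_def complete_graph_def simple_graph_def)
qed

lemma card_copies_complete_graph:
  assumes "finite (verts G)"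
  shows "card (copies (complete_graph k) G) = card (cliques k (verts G) (edges G))"
proof -
  have "copies (complete_graph k) G = (\<lambda>S. UGraph S ([S]\<^bsup>2\<^esup>)) ` cliques k (verts G) (edges G)"
    (is "?L = ?R")
  proof (intro equalityI subsetI)
    fix H assume "H \<in> ?L"
    then have H: "verts H \<subseteq> verts G" "edges H \<subseteq> edges G" "card (verts H) = k"
      "edges H = [verts H]\<^bsup>2\<^esup>"
      using isomorphic_complete_graph_iff[of k H] by (auto simp: copies_def subgraph_def)
    then have "H = UGraph (verts H) ([verts H]\<^bsup>2\<^esup>)" by (metis ugraph.collapse)
    moreover have "verts H \<in> cliques k (verts G) (edges G)" using H by (auto simp: cliques_def)
    ultimately show "H \<in> ?R" by blast
  next
    fix H assume "H \<in> ?R"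
    then obtain S where S: "S \<in> cliques k (verts G) (edges G)" "H = UGraph S ([S]\<^bsup>2\<^esup>)" by auto
    then have "finite S" using assms by (auto simp: cliques_def intro: finite_subset)
    then show "H \<in> ?L"
      using S isomorphic_complete_graph_iff[of k H] by (auto simp: copies_def subgraph_def cliques_def)
  qed
  moreover have "inj_on (\<lambda>S. UGraph S ([S]\<^bsup>2\<^esup>)) (cliques k (verts G) (edges G))"
    by (auto simp: inj_on_def)
  ultimately show ?thesis by (simp add: card_image)
qed

section \<open>Finiteness behind the extremal number\<close>

lemma cliques_subset_Union_cliques:
  assumes "S \<in> cliques r V E" "1 \<le> u" "u \<le> r" "finite V"
  shows "S \<subseteq> \<Union> (cliques u V E)"
proof
  fix x assume x: "x \<in> S"
  have fin: "finite S" using assms by (auto simp: cliques_def intro: finite_subset)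
  have "u - 1 \<le> card (S - {x})" using assms x fin by (auto simp: cliques_def)
  then obtain T where T: "T \<subseteq> S - {x}" "card T = u - 1" "finite T"
    using obtain_subset_with_card_n by metis
  have "card (insert x T) = u" using T assms(2) by (subst card_insert_disjoint) auto
  moreover have "[insert x T]\<^bsup>2\<^esup> \<subseteq> [S]\<^bsup>2\<^esup>" using T x by (intro nsets_mono) auto
  ultimately have "insert x T \<in> cliques u V E" using assms T x by (auto simp: cliques_def)
  then show "x \<in> \<Union> (cliques u V E)" by blast
qed

text \<open>An \<open>r\<close>-clique is covered by its \<open>u\<close>-subsets, which are
  \<open>u\<close>-cliques, so it is a subset of the union of all \<open>u\<close>-cliques. As the
  bound involves only \<open>u\<close> and the number of \<open>u\<close>-cliques, the set under
  \<open>Max\<close> in \<open>ex_u\<close> is finite.\<close>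

lemma card_cliques_le_two_power:
  assumes "1 \<le> u" "u \<le> r" "finite V"
  shows "card (cliques r V E) \<le> 2 ^ (card (cliques u V E) * u)"
proof -
  let ?U = "\<Union> (cliques u V E)"
  have finU: "finite ?U" using assms by (auto simp: cliques_def intro: finite_subset)
  have "card ?U \<le> (\<Sum>S \<in> cliques u V E. card S)"
    by (rule card_Union_le_sum_card)
  also have "\<dots> = card (cliques u V E) * u" by (simp add: cliques_def)
  finally have le: "card ?U \<le> card (cliques u V E) * u" .
  have "cliques r V E \<subseteq> Pow ?U" using cliques_subset_Union_cliques assms by blast
  then have "card (cliques r V E) \<le> card (Pow ?U)" using finU by (intro card_mono) auto
  also have "\<dots> = 2 ^ card ?U" using finU by (simp add: card_Pow)
  also have "\<dots> \<le> 2 ^ (card (cliques u V E) * u)" using le by (intro power_increasing) auto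
  finally show ?thesis .
qed

lemma ex_u_ge:
  fixes G :: "nat ugraph"
  assumes "1 \<le> u" "u \<le> r" "simple_graph G" "graph_free F G"
    and "card (copies (complete_graph u) G) = t"
  shows "card (copies (complete_graph r) G) \<le> ex_u u t (complete_graph r) F"
proof -
  let ?A = "{card (copies (complete_graph r) G) | G :: nat ugraph.
     simple_graph G \<and> graph_free F G \<and> card (copies (complete_graph u) G) = t}"
  have "?A \<subseteq> {..2 ^ (t * u)}"
    using card_cliques_le_two_power[OF assms(1,2)]
    by (auto simp: simple_graph_def card_copies_complete_graph)
  then have "finite ?A" by (rule finite_subset) simp
  then show ?thesis unfolding ex_u_def using assms by (intro Max_ge) auto
qed

section \<open>Padding by disjoint cliques\<close>

text \<open>Supplies any missing number of \<open>u\<close>-cliques on vertices that avoid a host on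
  \<open>{..<n}\<close>. All components are complete graphs on \<open>u\<close> vertices, so degrees
  inside any \<open>T\<close> are at most \<open>u - 1\<close>; this sparsity is what later rules
  out copies of \<open>F\<close>.\<close>

lemma exists_disjoint_cliques:
  fixes n u m :: nat
  assumes "2 \<le> u"
  shows "\<exists>N P. P \<subseteq> [{n..<n + N}]\<^bsup>2\<^esup> \<and> card (cliques u {n..<n + N} P) = m \<and>
    (\<forall>T. finite T \<longrightarrow> 2 * card {e \<in> P. e \<subseteq> T} \<le> (u - 1) * card T)"
proof (induction m)
  case 0
  have "cliques u {n..<n + 0} {} = {}" using assms by (auto simp: cliques_def)
  then show ?case by (intro exI[of _ 0] exI[of _ "{}"]) auto
next
  case (Suc m)
  then obtain N P where P: "P \<subseteq> [{n..<n + N}]\<^bsup>2\<^esup>" "card (cliques u {n..<n + N} P) = m"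
    and dens: "\<And>T. finite T \<Longrightarrow> 2 * card {e \<in> P. e \<subseteq> T} \<le> (u - 1) * card T" by blast
  define A where "A = {n..<n + N}"
  define B where "B = {n + N..<n + (N + u)}"
  have AB: "A \<inter> B = {}" "A \<union> B = {n..<n + (N + u)}" "finite A" "finite B" "card B = u"
    by (auto simp: A_def B_def)
  have PA: "P \<subseteq> [A]\<^bsup>2\<^esup>" using P by (simp add: A_def)
  have "cliques u B ([B]\<^bsup>2\<^esup>) = {B}"
    using AB by (auto simp: cliques_def dest: card_subset_eq)
  then have "card (cliques u (A \<union> B) (P \<union> [B]\<^bsup>2\<^esup>)) = Suc m"
    using card_cliques_disjoint_union[OF assms AB(1) PA subset_refl AB(3,4)] P
    by (simp add: A_def)
  moreover have "P \<union> [B]\<^bsup>2\<^esup> \<subseteq> [A \<union> B]\<^bsup>2\<^esup>"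
    using PA nsets_mono[of A "A \<union> B" 2] nsets_mono[of B "A \<union> B" 2] by auto
  moreover have "2 * card {e \<in> P \<union> [B]\<^bsup>2\<^esup>. e \<subseteq> T} \<le> (u - 1) * card T" if T: "finite T" for T
  proof -
    let ?s = "card (T \<inter> B)"
    have "{e \<in> P \<union> [B]\<^bsup>2\<^esup>. e \<subseteq> T} \<subseteq> {e \<in> P. e \<subseteq> T \<inter> A} \<union> [T \<inter> B]\<^bsup>2\<^esup>"
      using PA by (auto simp: nsets_def)
    moreover have "finite {e \<in> P. e \<subseteq> T \<inter> A}"
      by (rule finite_subset[of _ "Pow (T \<inter> A)"]) (use T in auto)
    moreover have "finite ([T \<inter> B]\<^bsup>2\<^esup>)"
      using T by (simp add: finite_imp_finite_nsets)
    ultimately have "card {e \<in> P \<union> [B]\<^bsup>2\<^esup>. e \<subseteq> T} \<le> card {e \<in> P. e \<subseteq> T \<inter> A} + card ([T \<inter> B]\<^bsup>2\<^esup>)"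
      by (meson card_Un_le card_mono finite_UnI le_trans)
    moreover have "2 * card ([T \<inter> B]\<^bsup>2\<^esup>) = ?s * (?s - 1)"
      by (cases ?s) (simp_all add: choose_two)
    moreover have "?s * (?s - 1) \<le> (u - 1) * ?s"
      using card_mono[of B "T \<inter> B"] AB by (simp add: mult.commute[of "u - 1"] diff_le_mono)
    moreover have "2 * card {e \<in> P. e \<subseteq> T \<inter> A} \<le> (u - 1) * card (T \<inter> A)"
      using dens[of "T \<inter> A"] T by simp
    moreover have "card (T \<inter> A) + ?s = card (T \<inter> A \<union> T \<inter> B)"
      using AB T by (intro card_Un_disjoint[symmetric]) auto
    then have "card (T \<inter> A) + ?s \<le> card T"
      using card_mono[of T "T \<inter> A \<union> T \<inter> B"] T by simp
    then have "(u - 1) * card (T \<inter> A) + (u - 1) * ?s \<le> (u - 1) * card T"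
      by (metis add_mult_distrib2 mult_le_mono2)
    ultimately show ?thesis by linarith
  qed
  ultimately show ?case
    unfolding AB(2) by (intro exI[of _ "N + u"] exI[of _ "P \<union> [B]\<^bsup>2\<^esup>"]) blast
qed

section \<open>Random subsets as weighted sums\<close>

text \<open>For \<open>E \<subseteq> P\<close> this is the probability that \<open>E\<close> is the
  outcome when each element of \<open>P\<close> is kept independently with probability
  \<open>p\<close>.\<close>

definition bernoulli_weight :: "real \<Rightarrow> 'a set \<Rightarrow> 'a set \<Rightarrow> real" where
  "bernoulli_weight p P E = p ^ card E * (1 - p) ^ card (P - E)"

lemma bernoulli_weight_nonneg: "0 \<le> p \<Longrightarrow> p \<le> 1 \<Longrightarrow> 0 \<le> bernoulli_weight p P E"
  by (simp add: bernoulli_weight_def)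

lemma sum_bernoulli_weight_superset:
  assumes "finite P" "A \<subseteq> P"
  shows "(\<Sum>E\<in>Pow P. bernoulli_weight p P E * of_bool (A \<subseteq> E)) = p ^ card A"
proof -
  \<comment> \<open>Weight 0 for discarding an element of \<open>A\<close>: expanding the product of
    \<open>p + ?g x\<close> then leaves exactly the outcomes that contain \<open>A\<close>, while
    the factors themselves are \<open>p\<close> on \<open>A\<close> and 1 elsewhere.\<close>
  let ?g = "\<lambda>x. if x \<in> A then 0 else 1 - p"
  have "p ^ card A = (\<Prod>x\<in>P. if x \<in> A then p else 1)"
    using assms by (simp add: prod.If_cases Int_absorb1)
  also have "\<dots> = (\<Prod>x\<in>P. p + ?g x)" by (intro prod.cong) auto
  also have "\<dots> = (\<Sum>E\<in>Pow P. (\<Prod>x\<in>E. p) * (\<Prod>x\<in>P - E. ?g x))"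
    using prod_add[of P "\<lambda>_. p" ?g] assms by simp
  also have "\<dots> = (\<Sum>E\<in>Pow P. bernoulli_weight p P E * of_bool (A \<subseteq> E))"
  proof (intro sum.cong refl)
    fix E assume E: "E \<in> Pow P"
    show "(\<Prod>x\<in>E. p) * (\<Prod>x\<in>P - E. ?g x) = bernoulli_weight p P E * of_bool (A \<subseteq> E)"
    proof (cases "A \<subseteq> E")
      case True
      then have "(\<Prod>x\<in>P - E. ?g x) = (\<Prod>x\<in>P - E. 1 - p)" by (intro prod.cong) auto
      then show ?thesis using True by (simp add: bernoulli_weight_def)
    next
      case False
      then have "\<exists>x\<in>P - E. ?g x = 0" using assms by auto
      then have "(\<Prod>x\<in>P - E. ?g x) = 0" using assms by (intro prod_zero) auto
      then show ?thesis using False by simp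
    qed
  qed
  finally show ?thesis by simp
qed

lemma exists_ge_bernoulli_mean:
  assumes "finite P" "0 \<le> p" "p \<le> 1" and m: "m \<le> (\<Sum>E\<in>Pow P. bernoulli_weight p P E * g E)"
  shows "\<exists>E\<subseteq>P. m \<le> g E"
proof (rule ccontr)
  assume "\<not> ?thesis"
  then have less: "g E < m" if "E \<in> Pow P" for E using that by (meson PowD not_le)
  have one: "(\<Sum>E\<in>Pow P. bernoulli_weight p P E) = 1"
    using sum_bernoulli_weight_superset[of P "{}" p] assms(1) by simp
  \<comment> \<open>Some weights may vanish, so the strict inequality of means needs an outcome of
    nonzero weight; one exists because the weights sum to 1.\<close>
  then obtain E where E: "E \<in> Pow P" "bernoulli_weight p P E \<noteq> 0"
    using sum.neutral[of "Pow P" "bernoulli_weight p P"] by fastforce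
  have "(\<Sum>E\<in>Pow P. bernoulli_weight p P E * g E) < (\<Sum>E\<in>Pow P. bernoulli_weight p P E * m)"
  proof (rule sum_strict_mono_ex1)
    show "\<forall>E\<in>Pow P. bernoulli_weight p P E * g E \<le> bernoulli_weight p P E * m"
      using less bernoulli_weight_nonneg[OF assms(2,3)] by (meson less_imp_le mult_left_mono)
    have "bernoulli_weight p P E * g E < bernoulli_weight p P E * m"
      using less[OF E(1)] E(2) bernoulli_weight_nonneg[OF assms(2,3), of P E]
      by (intro mult_strict_left_mono) auto
    then show "\<exists>E\<in>Pow P. bernoulli_weight p P E * g E < bernoulli_weight p P E * m"
      using E by blast
  qed (use assms in auto)
  also have "\<dots> = m" using one by (simp flip: sum_distrib_right)
  finally show False using m by simp
qed

section \<open>First and second moments of clique counts\<close>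

lemma card_nsets_2_Un:
  assumes "finite S" "finite T"
  shows "card ([S]\<^bsup>2\<^esup> \<union> [T]\<^bsup>2\<^esup>) + (card (S \<inter> T) choose 2) = (card S choose 2) + (card T choose 2)"
proof -
  have "[S]\<^bsup>2\<^esup> \<inter> [T]\<^bsup>2\<^esup> = [S \<inter> T]\<^bsup>2\<^esup>" by (auto simp: nsets_def)
  then show ?thesis
    using card_Un_Int[of "[S]\<^bsup>2\<^esup>" "[T]\<^bsup>2\<^esup>"] assms
    by (simp add: finite_imp_finite_nsets)
qed

lemma binomial_le_power: "n choose k \<le> n ^ k"
  by (cases "k \<le> n") (auto simp: binomial_le_pow binomial_eq_0)

text \<open>Group the sets \<open>T\<close> by their trace \<open>A\<close> on \<open>S\<close>. At
  most \<open>n ^ (u - card A)\<close> of them have trace \<open>A\<close>, so each of the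
  \<open>2 ^ card S\<close> traces contributes at most \<open>n ^ u\<close>.\<close>

lemma sum_power_card_Int_le:
  assumes "finite V" "finite S" "card V = n"
  shows "(\<Sum>T\<in>[V]\<^bsup>u\<^esup>. n ^ card (S \<inter> T)) \<le> 2 ^ card S * n ^ u"
proof -
  have fin: "finite ([V]\<^bsup>u\<^esup>)" using assms by (simp add: finite_imp_finite_nsets)
  have "(\<Sum>T\<in>[V]\<^bsup>u\<^esup>. n ^ card (S \<inter> T))
      = (\<Sum>A\<in>Pow S. \<Sum>T\<in>{T \<in> [V]\<^bsup>u\<^esup>. S \<inter> T = A}. n ^ card (S \<inter> T))"
    using fin assms by (subst sum.group) auto
  also have "\<dots> \<le> (\<Sum>A\<in>Pow S. n ^ u)"
  proof (rule sum_mono)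
    fix A assume "A \<in> Pow S"
    then have finA: "finite A" using assms finite_subset by auto
    let ?X = "{T \<in> [V]\<^bsup>u\<^esup>. S \<inter> T = A}"
    have "(\<Sum>T\<in>?X. n ^ card (S \<inter> T)) = (\<Sum>T\<in>?X. n ^ card A)"
      by (intro sum.cong) auto
    also have "\<dots> = card ?X * n ^ card A" by simp
    also have "\<dots> \<le> n ^ u"
    \<comment> \<open>Only a nonempty class guarantees \<open>card A \<le> u\<close>, which the
      truncated difference \<open>u - card A\<close> requires.\<close>
    proof (cases "?X = {}")
      case False
      then obtain T0 where "T0 \<in> ?X" by blast
      then have "card A \<le> u" by (auto simp: nsets_def intro: card_mono)
      have "inj_on (\<lambda>T. T - A) ?X"
        by (auto simp: inj_on_def)
      moreover have "(\<lambda>T. T - A) ` ?X \<subseteq> [V]\<^bsup>(u - card A)\<^esup>"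
        by (auto simp: nsets_def card_Diff_subset_Int Int_commute)
      ultimately have "card ?X \<le> card ([V]\<^bsup>(u - card A)\<^esup>)"
        using assms by (intro card_inj_on_le) (auto simp: finite_imp_finite_nsets)
      also have "\<dots> \<le> n ^ (u - card A)" using assms by (simp add: binomial_le_power)
      finally have "card ?X * n ^ card A \<le> n ^ (u - card A) * n ^ card A" by simp
      also have "\<dots> = n ^ u" using \<open>card A \<le> u\<close> by (simp flip: power_add)
      finally show ?thesis .
    qed (simp only: card.empty mult_0 le0)
    finally show "(\<Sum>T\<in>?X. n ^ card (S \<inter> T)) \<le> n ^ u" .
  qed
  also have "\<dots> = 2 ^ card S * n ^ u" using assms by (simp add: card_Pow)
  finally show ?thesis .
qed

text \<open>Sharing \<open>s\<close> vertices raises the probability of a pair of cliques by the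
  factor \<open>1 / p ^ (s choose 2)\<close>, which \<open>low\<close> bounds by
  \<open>n ^ s / \<kappa>\<close>. Summed over \<open>T\<close>, these factors cost only a constant,
  so overlapping pairs do not spoil the order of magnitude of the independent case.\<close>

lemma sum_power_card_clique_pairs_le:
  fixes p \<kappa> :: real
  assumes V: "finite V" "card V = n" and S: "S \<in> [V]\<^bsup>r\<^esup>" and p: "0 < p" and \<kappa>: "0 < \<kappa>"
    and low: "\<And>s. s \<le> u \<Longrightarrow> \<kappa> \<le> real n ^ s * p ^ (s choose 2)"
  shows "(\<Sum>T\<in>[V]\<^bsup>u\<^esup>. p ^ card ([S]\<^bsup>2\<^esup> \<union> [T]\<^bsup>2\<^esup>))
    \<le> 2 ^ r / \<kappa> * real n ^ u * p ^ (r choose 2) * p ^ (u choose 2)"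
proof -
  let ?q = "p ^ (r choose 2) * p ^ (u choose 2)"
  have S': "finite S" "card S = r" using S by (auto simp: nsets_def)
  have "p ^ card ([S]\<^bsup>2\<^esup> \<union> [T]\<^bsup>2\<^esup>) \<le> ?q / \<kappa> * real (n ^ card (S \<inter> T))" if "T \<in> [V]\<^bsup>u\<^esup>" for T
  proof -
    let ?s = "card (S \<inter> T)"
    have T: "finite T" "card T = u" using that by (auto simp: nsets_def)
    have su: "?s \<le> u" using T by (auto intro: card_mono)
    have "p ^ card ([S]\<^bsup>2\<^esup> \<union> [T]\<^bsup>2\<^esup>) * p ^ (?s choose 2) = ?q"
      using card_nsets_2_Un[of S T] S' T by (simp flip: power_add)
    moreover have "p ^ card ([S]\<^bsup>2\<^esup> \<union> [T]\<^bsup>2\<^esup>) * \<kappa>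
        \<le> p ^ card ([S]\<^bsup>2\<^esup> \<union> [T]\<^bsup>2\<^esup>) * (real n ^ ?s * p ^ (?s choose 2))"
      using low[OF su] p by (intro mult_left_mono) auto
    ultimately have "p ^ card ([S]\<^bsup>2\<^esup> \<union> [T]\<^bsup>2\<^esup>) * \<kappa> \<le> ?q * real n ^ ?s"
      by (simp add: mult_ac)
    then show ?thesis using \<kappa> by (simp add: field_simps)
  qed
  then have "(\<Sum>T\<in>[V]\<^bsup>u\<^esup>. p ^ card ([S]\<^bsup>2\<^esup> \<union> [T]\<^bsup>2\<^esup>))
      \<le> (\<Sum>T\<in>[V]\<^bsup>u\<^esup>. ?q / \<kappa> * real (n ^ card (S \<inter> T)))"
    by (rule sum_mono)
  also have "\<dots> = ?q / \<kappa> * real (\<Sum>T\<in>[V]\<^bsup>u\<^esup>. n ^ card (S \<inter> T))"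
    by (simp add: sum_distrib_left)
  also have "\<dots> \<le> ?q / \<kappa> * real (2 ^ r * n ^ u)"
    using sum_power_card_Int_le[of V S n u] V S' p \<kappa>
    by (intro mult_left_mono) (auto simp del: of_nat_mult of_nat_power of_nat_sum)
  finally show ?thesis by (simp add: mult_ac)
qed

lemma card_cliques_eq_sum:
  assumes "finite V"
  shows "real (card (cliques k V E)) = (\<Sum>S\<in>[V]\<^bsup>k\<^esup>. of_bool ([S]\<^bsup>2\<^esup> \<subseteq> E))"
proof -
  have "cliques k V E = {S \<in> [V]\<^bsup>k\<^esup>. [S]\<^bsup>2\<^esup> \<subseteq> E}"
    using assms by (auto simp: cliques_def nsets_def intro: finite_subset)
  then show ?thesis using assms by (simp add: finite_imp_finite_nsets Int_def)
qed

text \<open>Subtracting the product of the two clique counts makes one first-moment computation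
  control both of them at once: wherever the functional is positive, the number of
  \<open>u\<close>-cliques is below \<open>L\<close>.\<close>

lemma exists_edge_set_ge_mean:
  fixes p \<kappa> L M :: real
  assumes V: "finite V" "card V = n" and p: "0 < p" "p \<le> 1" and \<kappa>: "0 < \<kappa>" and "0 < L"
    and low: "\<And>s. s \<le> u \<Longrightarrow> \<kappa> \<le> real n ^ s * p ^ (s choose 2)"
    and J: "finite J" "\<And>j. j \<in> J \<Longrightarrow> A j \<subseteq> [V]\<^bsup>2\<^esup> \<and> card (A j) = e"
  shows "\<exists>E \<subseteq> [V]\<^bsup>2\<^esup>.
    real (n choose r) * p ^ (r choose 2) - M * (real (card J) * p ^ e)
      - real (n choose r) * (2 ^ r / \<kappa> * real n ^ u * p ^ (r choose 2) * p ^ (u choose 2)) / L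
    \<le> real (card (cliques r V E)) - M * real (card {j \<in> J. A j \<subseteq> E})
      - real (card (cliques r V E)) * real (card (cliques u V E)) / L"
proof (rule exists_ge_bernoulli_mean[of "[V]\<^bsup>2\<^esup>" p])
  let ?P = "[V]\<^bsup>2\<^esup>" and ?w = "bernoulli_weight p ([V]\<^bsup>2\<^esup>)"
  show finP: "finite ?P" using V by (simp add: finite_imp_finite_nsets)
  have finN: "finite ([V]\<^bsup>k\<^esup>)" for k using V by (simp add: finite_imp_finite_nsets)
  have sub: "[S]\<^bsup>2\<^esup> \<subseteq> ?P" if "S \<in> [V]\<^bsup>k\<^esup>" for S k
    using that by (intro nsets_mono) (auto simp: nsets_def)
  have cardS: "card ([S]\<^bsup>2\<^esup>) = r choose 2" if "S \<in> [V]\<^bsup>r\<^esup>" for S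
    using that by (auto simp: nsets_def[of V])
  have X: "(\<Sum>E\<in>Pow ?P. ?w E * real (card (cliques r V E))) = real (n choose r) * p ^ (r choose 2)"
  proof -
    have "(\<Sum>E\<in>Pow ?P. ?w E * real (card (cliques r V E)))
        = (\<Sum>E\<in>Pow ?P. \<Sum>S\<in>[V]\<^bsup>r\<^esup>. ?w E * of_bool ([S]\<^bsup>2\<^esup> \<subseteq> E))"
      by (simp add: card_cliques_eq_sum V sum_distrib_left)
    also have "\<dots> = (\<Sum>S\<in>[V]\<^bsup>r\<^esup>. \<Sum>E\<in>Pow ?P. ?w E * of_bool ([S]\<^bsup>2\<^esup> \<subseteq> E))"
      by (rule sum.swap)
    also have "\<dots> = (\<Sum>S\<in>[V]\<^bsup>r\<^esup>. p ^ (r choose 2))"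
      using sum_bernoulli_weight_superset[OF finP sub] cardS by (intro sum.cong) auto
    finally show ?thesis using V by simp
  qed
  have Jm: "(\<Sum>E\<in>Pow ?P. ?w E * real (card {j \<in> J. A j \<subseteq> E})) = real (card J) * p ^ e"
  proof -
    have "(\<Sum>E\<in>Pow ?P. ?w E * real (card {j \<in> J. A j \<subseteq> E}))
        = (\<Sum>E\<in>Pow ?P. \<Sum>j\<in>J. ?w E * of_bool (A j \<subseteq> E))"
      using J by (simp add: Int_def flip: sum_distrib_left)
    also have "\<dots> = (\<Sum>j\<in>J. \<Sum>E\<in>Pow ?P. ?w E * of_bool (A j \<subseteq> E))"
      by (rule sum.swap)
    also have "\<dots> = (\<Sum>j\<in>J. p ^ e)"
      using sum_bernoulli_weight_superset[OF finP] J by (intro sum.cong) auto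
    finally show ?thesis by simp
  qed
  \<comment> \<open>An upper bound suffices, since this product is subtracted. The product of two
    indicators is the indicator that the union of both edge sets is present.\<close>
  have XY: "(\<Sum>E\<in>Pow ?P. ?w E * (real (card (cliques r V E)) * real (card (cliques u V E))))
      \<le> real (n choose r) * (2 ^ r / \<kappa> * real n ^ u * p ^ (r choose 2) * p ^ (u choose 2))"
  proof -
    have "(\<Sum>E\<in>Pow ?P. ?w E * (real (card (cliques r V E)) * real (card (cliques u V E))))
        = (\<Sum>E\<in>Pow ?P. \<Sum>S\<in>[V]\<^bsup>r\<^esup>. \<Sum>T\<in>[V]\<^bsup>u\<^esup>. ?w E * of_bool ([S]\<^bsup>2\<^esup> \<union> [T]\<^bsup>2\<^esup> \<subseteq> E))"
      unfolding card_cliques_eq_sum[OF V(1)] sum_product by (simp add: sum_distrib_left of_bool_conj)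
    also have "\<dots> = (\<Sum>S\<in>[V]\<^bsup>r\<^esup>. \<Sum>E\<in>Pow ?P. \<Sum>T\<in>[V]\<^bsup>u\<^esup>. ?w E * of_bool ([S]\<^bsup>2\<^esup> \<union> [T]\<^bsup>2\<^esup> \<subseteq> E))"
      by (rule sum.swap)
    also have "\<dots> = (\<Sum>S\<in>[V]\<^bsup>r\<^esup>. \<Sum>T\<in>[V]\<^bsup>u\<^esup>. \<Sum>E\<in>Pow ?P. ?w E * of_bool ([S]\<^bsup>2\<^esup> \<union> [T]\<^bsup>2\<^esup> \<subseteq> E))"
      by (intro sum.cong refl sum.swap)
    also have "\<dots> = (\<Sum>S\<in>[V]\<^bsup>r\<^esup>. \<Sum>T\<in>[V]\<^bsup>u\<^esup>. p ^ card ([S]\<^bsup>2\<^esup> \<union> [T]\<^bsup>2\<^esup>))"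
      by (intro sum.cong refl sum_bernoulli_weight_superset finP Un_least sub)
    also have "\<dots> \<le> (\<Sum>S\<in>[V]\<^bsup>r\<^esup>. 2 ^ r / \<kappa> * real n ^ u * p ^ (r choose 2) * p ^ (u choose 2))"
      using sum_power_card_clique_pairs_le[OF V _ p(1) \<kappa> low] by (intro sum_mono)
    finally show ?thesis using V by simp
  qed
  have "(\<Sum>E\<in>Pow ?P. ?w E * (real (card (cliques r V E)) - M * real (card {j \<in> J. A j \<subseteq> E})
      - real (card (cliques r V E)) * real (card (cliques u V E)) / L))
    = (\<Sum>E\<in>Pow ?P. ?w E * real (card (cliques r V E)))
      - M * (\<Sum>E\<in>Pow ?P. ?w E * real (card {j \<in> J. A j \<subseteq> E}))
      - (\<Sum>E\<in>Pow ?P. ?w E * (real (card (cliques r V E)) * real (card (cliques u V E)))) / L"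
    unfolding right_diff_distrib sum_subtractf sum_distrib_left sum_divide_distrib
    by (simp add: mult_ac)
  then show "real (n choose r) * p ^ (r choose 2) - M * (real (card J) * p ^ e)
      - real (n choose r) * (2 ^ r / \<kappa> * real n ^ u * p ^ (r choose 2) * p ^ (u choose 2)) / L
    \<le> (\<Sum>E\<in>Pow ?P. ?w E * (real (card (cliques r V E)) - M * real (card {j \<in> J. A j \<subseteq> E})
      - real (card (cliques r V E)) * real (card (cliques u V E)) / L))"
    using X Jm divide_right_mono[OF XY, of L] \<open>0 < L\<close> by simp
qed (use p in auto)

section \<open>Deleting one edge from every embedding\<close>

text \<open>The map is constrained only on endpoints of edges in \<open>A\<close>, so isolated
  vertices need no image in the host.\<close>

definition edge_embedding :: "('a \<Rightarrow> 'b) \<Rightarrow> 'a set set \<Rightarrow> 'b set set \<Rightarrow> bool" where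
  "edge_embedding f A E \<longleftrightarrow> inj_on f (\<Union>A) \<and> (\<forall>e\<in>A. f ` e \<in> E)"

lemma card_nsets_superset_le:
  assumes "finite V" "card V = n" "d \<in> [V]\<^bsup>2\<^esup>"
  shows "card {S \<in> [V]\<^bsup>r\<^esup>. d \<subseteq> S} \<le> n ^ (r - 2)"
proof -
  have d: "finite d" "card d = 2" using assms by (auto simp: nsets_def)
  have "inj_on (\<lambda>S. S - d) {S \<in> [V]\<^bsup>r\<^esup>. d \<subseteq> S}" by (auto simp: inj_on_def)
  moreover have "(\<lambda>S. S - d) ` {S \<in> [V]\<^bsup>r\<^esup>. d \<subseteq> S} \<subseteq> [V]\<^bsup>(r - 2)\<^esup>"
    using d by (auto simp: nsets_def card_Diff_subset)
  ultimately have "card {S \<in> [V]\<^bsup>r\<^esup>. d \<subseteq> S} \<le> card ([V]\<^bsup>(r - 2)\<^esup>)"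
    using assms by (intro card_inj_on_le) (auto simp: finite_imp_finite_nsets)
  also have "\<dots> \<le> n ^ (r - 2)" using assms by (simp add: binomial_le_power)
  finally show ?thesis .
qed

text \<open>Every lost clique contains a deleted edge, and each edge lies in at most
  \<open>n ^ (r - 2)\<close> sets of \<open>r\<close> vertices.\<close>

lemma card_cliques_le_after_deletion:
  assumes V: "finite V" "card V = n" and D: "finite D" "D \<subseteq> [V]\<^bsup>2\<^esup>"
  shows "card (cliques r V E) \<le> card (cliques r V (E - D)) + card D * n ^ (r - 2)"
proof -
  let ?X = "\<Union>d\<in>D. {S \<in> [V]\<^bsup>r\<^esup>. d \<subseteq> S}"
  have "cliques r V E \<subseteq> cliques r V (E - D) \<union> ?X"
  proof
    fix S assume S: "S \<in> cliques r V E"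
    then have Sr: "S \<in> [V]\<^bsup>r\<^esup>" using V by (auto simp: cliques_def nsets_def intro: finite_subset)
    show "S \<in> cliques r V (E - D) \<union> ?X"
    proof (cases "[S]\<^bsup>2\<^esup> \<inter> D = {}")
      case True
      then show ?thesis using S by (auto simp: cliques_def)
    next
      case False
      then obtain d where "d \<in> D" "d \<in> [S]\<^bsup>2\<^esup>" by blast
      then have "d \<subseteq> S" by (auto simp: nsets_def)
      then show ?thesis using Sr \<open>d \<in> D\<close> by blast
    qed
  qed
  moreover have "finite ?X" using V D by (auto simp: finite_imp_finite_nsets)
  ultimately have "card (cliques r V E) \<le> card (cliques r V (E - D)) + card ?X"
    by (meson V(1) card_Un_le card_mono finite_UnI finite_cliques le_trans)
  moreover have "card ?X \<le> (\<Sum>d\<in>D. card {S \<in> [V]\<^bsup>r\<^esup>. d \<subseteq> S})"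
    by (rule card_UN_le[OF D(1)])
  moreover have "\<dots> \<le> (\<Sum>d\<in>D. n ^ (r - 2))"
    using card_nsets_superset_le[OF V] D by (intro sum_mono) auto
  ultimately show ?thesis by simp
qed

text \<open>Fix one edge of \<open>A\<close> and delete its image under every embedding into
  \<open>E\<close>. Extensional functions in \<open>J\<close> keep the number of embeddings
  finite.\<close>

lemma exists_embedding_free_subset:
  fixes A :: "'a set set" and E :: "'b set set"
  assumes V: "finite V" "card V = n" and E: "E \<subseteq> [V]\<^bsup>2\<^esup>"
    and A: "finite (\<Union>A)" "A \<noteq> {}"
  defines "J \<equiv> {f \<in> \<Union>A \<rightarrow>\<^sub>E V. inj_on f (\<Union>A)}"
  shows "\<exists>E'\<subseteq>E. (\<forall>f. \<not> edge_embedding f A E') \<and>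
    card (cliques r V E) \<le> card (cliques r V E') + card {f \<in> J. (`) f ` A \<subseteq> E} * n ^ (r - 2)"
proof -
  obtain a where a: "a \<in> A" using A by auto
  let ?J = "{f \<in> J. (`) f ` A \<subseteq> E}"
  define D where "D = (\<lambda>f. f ` a) ` ?J"
  have finJ: "finite ?J"
    using finite_PiE[OF A(1), of "\<lambda>_. V"] V by (auto simp: J_def)
  then have D: "finite D" "card D \<le> card ?J" by (auto simp: D_def card_image_le)
  have DV: "D \<subseteq> [V]\<^bsup>2\<^esup>" using a E by (auto simp: D_def)
  have "\<not> edge_embedding f A (E - D)" for f
  proof
    assume f: "edge_embedding f A (E - D)"
    \<comment> \<open>A surviving embedding, made extensional, is a member of \<open>?J\<close>, so
      the image of \<open>a\<close> has been deleted.\<close>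
    define g where "g = restrict f (\<Union>A)"
    have gf: "g ` e = f ` e" if "e \<in> A" for e using that by (auto simp: g_def)
    have "f x \<in> V" if "x \<in> e" "e \<in> A" for x e
    proof -
      have "f ` e \<in> [V]\<^bsup>2\<^esup>" using f that E by (auto simp: edge_embedding_def)
      then show ?thesis using that by (auto simp: nsets_def)
    qed
    then have "g \<in> \<Union>A \<rightarrow>\<^sub>E V" by (auto simp: g_def)
    moreover have "inj_on g (\<Union>A)" using f by (simp add: edge_embedding_def g_def inj_on_def)
    moreover have "(`) g ` A \<subseteq> E" using f gf by (auto simp: edge_embedding_def)
    ultimately have "g \<in> ?J" by (simp add: J_def)
    then have "g ` a \<in> D" unfolding D_def by (rule imageI)
    then have "f ` a \<in> D" using gf[OF a] by simp
    then show False using f a by (auto simp: edge_embedding_def)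
  qed
  moreover have "card (cliques r V E) \<le> card (cliques r V (E - D)) + card ?J * n ^ (r - 2)"
    using card_cliques_le_after_deletion[OF V D(1) DV, of r E] D(2)
    by (meson add_left_mono le_trans mult_le_mono1)
  ultimately show ?thesis by (intro exI[of _ "E - D"]) auto
qed

section \<open>The random host graph\<close>

lemma real_choose_two: "real (k choose 2) = real k * (real k - 1) / 2"
  by (cases k) (simp_all add: choose_two real_of_nat_div algebra_simps)

text \<open>The expression is the exponent of \<open>n\<close> in
  \<open>n ^ s * p ^ (s choose 2)\<close> when \<open>p\<close> has order \<open>n powr - a\<close>,
  and it factors as \<open>s / 2 * (2 - a * (s - 1))\<close>.\<close>

lemma sub_mult_choose_two_nonneg:
  assumes "s \<le> r" "0 \<le> a" "a * (real r - 1) \<le> 2"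
  shows "0 \<le> real s - a * real (s choose 2)"
proof -
  have "a * (real s - 1) \<le> a * (real r - 1)" using assms by (intro mult_left_mono) auto
  then have "0 \<le> real s / 2 * (2 - a * (real s - 1))" using assms by (intro mult_nonneg_nonneg) auto
  also have "\<dots> = real s - a * real (s choose 2)" by (simp add: real_choose_two field_simps)
  finally show ?thesis .
qed

lemma power_mult_scaled_powr:
  fixes a c :: real
  assumes "n > 0"
  shows "real n ^ s * (c * real n powr - a) ^ k = c ^ k * real n powr (real s - a * real k)"
proof -
  have "(real n powr - a) ^ k = real n powr (- (a * real k))"
    using assms by (simp add: powr_powr flip: powr_realpow)
  moreover have "real n ^ s = real n powr real s" using assms by (simp add: powr_realpow)
  ultimately show ?thesis by (simp add: power_mult_distrib flip: powr_add)
qed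

text \<open>In the mean of the functional, the main term is at least \<open>4 * c * \<mu>\<close>
  and each of the two losses is at most \<open>c * \<mu>\<close>. An outcome with value at least
  \<open>2 * c * \<mu>\<close> remains, and deletion then turns it into the required edge
  set.\<close>

lemma exists_dense_embedding_free:
  fixes A :: "'a set set" and a :: real
  assumes ur: "u \<le> r" "2 \<le> r" and W: "finite W" "card W = v" "2 < v"
    and A: "A \<subseteq> [W]\<^bsup>2\<^esup>" "card A = e" "(r choose 2) < e"
    and a: "a * (real e - real (r choose 2)) = real v - 2" "a * (real r - 1) \<le> 2"
  shows "\<exists>K>0. \<exists>c>0. \<forall>n\<ge>r. \<exists>E\<subseteq>[{..<n}]\<^bsup>2\<^esup>. (\<forall>f. \<not> edge_embedding f A E) \<and>
    c * real n powr (real r - a * real (r choose 2)) \<le> real (card (cliques r {..<n} E)) \<and>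
    real (card (cliques u {..<n} E)) \<le> K * real n powr (real u - a * real (u choose 2))"
proof -
  let ?C = "r choose 2"
  \<comment> \<open>Chosen so that \<open>n choose r\<close>, which is at least
    \<open>(n / r) ^ r\<close>, is at least \<open>4 * c * n ^ r\<close>.\<close>
  define c :: real where "c = 1 / (4 * real r ^ r)"
  \<comment> \<open>A common lower bound for \<open>n ^ s * p ^ (s choose 2)\<close> over all
    \<open>s \<le> u\<close>, valid because \<open>c \<le> 1\<close> and the exponents of
    \<open>n\<close> are nonnegative.\<close>
  define \<kappa> where "\<kappa> = c ^ (u choose 2)"
  \<comment> \<open>Makes the clique-pair term at most \<open>c * \<mu>\<close> after division by
    \<open>L\<close>.\<close>
  define K where "K = 2 ^ r / (\<kappa> * c)"
  have rr: "1 \<le> real r ^ r" using ur by (intro one_le_power) simp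
  have c: "0 < c" "c \<le> 1" using rr by (auto simp: c_def divide_le_eq)
  have \<kappa>: "0 < \<kappa>" using c by (simp add: \<kappa>_def)
  have K: "0 < K" using c \<kappa> by (simp add: K_def)
  have a0: "0 \<le> a"
  proof (rule ccontr)
    assume "\<not> 0 \<le> a"
    then have "a * (real e - real ?C) \<le> 0" using A(3) by (intro mult_nonpos_nonneg) auto
    then show False using a(1) W(3) by simp
  qed
  have UA: "\<Union>A \<subseteq> W" using A by (auto simp: nsets_def)
  then have finUA: "finite (\<Union>A)" and cardUA: "card (\<Union>A) \<le> v"
    using W by (auto intro: finite_subset card_mono)
  have "A \<noteq> {}" using A by auto
  have main: "\<exists>E\<subseteq>[{..<n}]\<^bsup>2\<^esup>. (\<forall>f. \<not> edge_embedding f A E) \<and>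
      (2 * c * c ^ ?C) * real n powr (real r - a * real ?C) \<le> real (card (cliques r {..<n} E)) \<and>
      real (card (cliques u {..<n} E)) \<le> K * real n powr (real u - a * real (u choose 2))"
    if n: "n \<ge> r" for n
  proof -
    have n0: "n > 0" using n ur by simp
    define p where "p = c * real n powr - a"
    define \<mu> where "\<mu> = c ^ ?C * real n powr (real r - a * real ?C)"
    define L where "L = K * real n powr (real u - a * real (u choose 2))"
    define J where "J = {f \<in> \<Union>A \<rightarrow>\<^sub>E {..<n}. inj_on f (\<Union>A)}"
    have p: "0 < p" "p \<le> 1"
    proof -
      show "0 < p" using c n0 by (simp add: p_def)
      have "real n powr - a \<le> real n powr 0" using n0 a0 by (intro powr_mono) auto
      then show "p \<le> 1" using c n0 by (simp add: p_def mult_le_one)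
    qed
    have \<mu>: "0 < \<mu>" using c n0 by (simp add: \<mu>_def)
    have L: "0 < L" using K n0 by (simp add: L_def)
    have low: "\<kappa> \<le> real n ^ s * p ^ (s choose 2)" if "s \<le> u" for s
    proof -
      have "1 \<le> real n powr (real s - a * real (s choose 2))"
        using sub_mult_choose_two_nonneg[of s r a] that ur a0 a(2) n0 by (intro ge_one_powr_ge_zero) auto
      moreover have "\<kappa> \<le> c ^ (s choose 2)"
        unfolding \<kappa>_def using c that by (intro power_decreasing binomial_right_mono) auto
      ultimately have "\<kappa> * 1 \<le> c ^ (s choose 2) * real n powr (real s - a * real (s choose 2))"
        using \<kappa> c by (intro mult_mono) auto
      then show ?thesis using power_mult_scaled_powr[OF n0] by (simp add: p_def)
    qed
    have finJ: "finite J" using finite_PiE[OF finUA, of "\<lambda>_. {..<n}"] by (auto simp: J_def)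
    have "card J \<le> card (\<Union>A \<rightarrow>\<^sub>E {..<n})"
      using finite_PiE[OF finUA, of "\<lambda>_. {..<n}"] by (intro card_mono) (auto simp: J_def)
    also have "\<dots> = n ^ card (\<Union>A)" using finUA by (simp add: card_funcsetE)
    \<comment> \<open>Isolated vertices can only make \<open>card (\<Union>A)\<close> smaller than
      \<open>v\<close>.\<close>
    also have "\<dots> \<le> n ^ v" using cardUA n0 by (intro power_increasing) auto
    finally have cardJ: "card J \<le> n ^ v" .
    have AJ: "(`) f ` A \<subseteq> [{..<n}]\<^bsup>2\<^esup> \<and> card ((`) f ` A) = e" if f: "f \<in> J" for f
    proof
      show "(`) f ` A \<subseteq> [{..<n}]\<^bsup>2\<^esup>"
      proof
        fix y assume "y \<in> (`) f ` A"
        then obtain x where x: "x \<in> A" "y = f ` x" by auto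
        have "inj_on f x" using f x by (auto simp: J_def intro: inj_on_subset)
        moreover have "f ` x \<subseteq> {..<n}" using f x by (auto simp: J_def PiE_iff)
        ultimately show "y \<in> [{..<n}]\<^bsup>2\<^esup>" using x A by (auto simp: nsets_def card_image)
      qed
      have "inj_on f (\<Union>A)" using f by (simp add: J_def)
      then have "inj_on ((`) f) A"
        by (intro inj_onI) (metis Union_upper inj_on_image_eq_iff)
      then show "card ((`) f ` A) = e" using A by (simp add: card_image)
    qed
    have L2: "real (n ^ (r - 2)) * (real (card J) * p ^ e) \<le> c * \<mu>"
    proof -
      have "real (n ^ (r - 2)) * (real (card J) * p ^ e) \<le> real n ^ (r - 2) * (real n ^ v * p ^ e)"
      proof -
        have "real (card J) \<le> real n ^ v" using cardJ by (metis of_nat_le_iff of_nat_power)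
        then show ?thesis using p by (simp add: mult_left_mono mult_right_mono)
      qed
      also have "\<dots> = real n ^ (r - 2 + v) * p ^ e" by (simp add: power_add)
      also have "\<dots> = c ^ e * real n powr (real (r - 2 + v) - a * real e)"
        unfolding p_def by (rule power_mult_scaled_powr[OF n0])
      \<comment> \<open>The balance equation \<open>a(1)\<close> gives the expected deletion loss
        the same power of \<open>n\<close> as the expected number of \<open>r\<close>-cliques. The
        strict inequality \<open>(r choose 2) < e\<close> then yields the extra factor
        \<open>c\<close>.\<close>
      also have "real (r - 2 + v) - a * real e = real r - a * real ?C"
        using a(1) ur by (simp add: algebra_simps)
      also have "c ^ e * real n powr (real r - a * real ?C)
          \<le> c ^ Suc ?C * real n powr (real r - a * real ?C)"
        using c A(3) by (intro mult_right_mono power_decreasing) auto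
      finally show ?thesis by (simp add: \<mu>_def)
    qed
    have npC: "real n ^ r * p ^ ?C = \<mu>"
      unfolding \<mu>_def p_def by (rule power_mult_scaled_powr[OF n0])
    have X1: "4 * c * \<mu> \<le> real (n choose r) * p ^ ?C"
    proof -
      have "4 * c * \<mu> = (real n / real r) ^ r * p ^ ?C"
        using npC by (simp add: c_def power_divide)
      also have "\<dots> \<le> real (n choose r) * p ^ ?C"
        using binomial_ge_n_over_k_pow_k[OF n, where 'a = real] p by (intro mult_right_mono) auto
      finally show ?thesis .
    qed
    have X2: "real (n choose r) * p ^ ?C \<le> \<mu>"
    proof -
      have "real (n choose r) \<le> real n ^ r" 
        using binomial_le_power[of n r] by (metis of_nat_le_iff of_nat_power)
      then show ?thesis using p npC by (metis mult_right_mono zero_le_power less_imp_le)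
    qed
    have X3: "real (n choose r) * (2 ^ r / \<kappa> * real n ^ u * p ^ ?C * p ^ (u choose 2)) / L \<le> c * \<mu>"
    proof -
      have "real n ^ u * p ^ (u choose 2) \<le> 1 * real n powr (real u - a * real (u choose 2))"
        unfolding p_def power_mult_scaled_powr[OF n0] using c
        by (intro mult_right_mono power_le_one) auto
      then have "2 ^ r / \<kappa> * (real n ^ u * p ^ (u choose 2)) \<le> 2 ^ r / \<kappa> * real n powr (real u - a * real (u choose 2))"
        using \<kappa> by (intro mult_left_mono) auto
      also have "\<dots> = c * L" using c \<kappa> by (simp add: L_def K_def)
      finally have "(real (n choose r) * p ^ ?C) * (2 ^ r / \<kappa> * (real n ^ u * p ^ (u choose 2))) \<le> \<mu> * (c * L)"
        using X2 \<mu> p \<kappa> by (intro mult_mono[OF X2]) auto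
      then have "(real (n choose r) * p ^ ?C) * (2 ^ r / \<kappa> * (real n ^ u * p ^ (u choose 2))) / L
          \<le> \<mu> * (c * L) / L"
        using L by (intro divide_right_mono) auto
      also have "\<mu> * (c * L) / L = c * \<mu>" using L by simp
      finally show ?thesis by (simp only: mult_ac)
    qed
    have "\<exists>E\<subseteq>[{..<n}]\<^bsup>2\<^esup>.
        real (n choose r) * p ^ ?C - real (n ^ (r - 2)) * (real (card J) * p ^ e)
          - real (n choose r) * (2 ^ r / \<kappa> * real n ^ u * p ^ ?C * p ^ (u choose 2)) / L
        \<le> real (card (cliques r {..<n} E)) - real (n ^ (r - 2)) * real (card {f \<in> J. (`) f ` A \<subseteq> E})
          - real (card (cliques r {..<n} E)) * real (card (cliques u {..<n} E)) / L"
      by (rule exists_edge_set_ge_mean[where V = "{..<n}" and A = "\<lambda>f. (`) f ` A",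
          OF finite_lessThan card_lessThan p \<kappa> L low finJ AJ])
    then obtain E where E: "E \<subseteq> [{..<n}]\<^bsup>2\<^esup>" and
      mean: "real (n choose r) * p ^ ?C - real (n ^ (r - 2)) * (real (card J) * p ^ e)
        - real (n choose r) * (2 ^ r / \<kappa> * real n ^ u * p ^ ?C * p ^ (u choose 2)) / L
      \<le> real (card (cliques r {..<n} E)) - real (n ^ (r - 2)) * real (card {f \<in> J. (`) f ` A \<subseteq> E})
        - real (card (cliques r {..<n} E)) * real (card (cliques u {..<n} E)) / L"
      by (elim exE conjE)
    let ?X = "real (card (cliques r {..<n} E))" and ?Y = "real (card (cliques u {..<n} E))"
    have pos: "2 * c * \<mu> \<le> ?X - real (n ^ (r - 2)) * real (card {f \<in> J. (`) f ` A \<subseteq> E}) - ?X * ?Y / L"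
      using mean L2 X1 X3 by simp
    obtain E' where E': "E' \<subseteq> E" "\<And>f. \<not> edge_embedding f A E'"
      and del: "card (cliques r {..<n} E) \<le>
        card (cliques r {..<n} E') + card {f \<in> J. (`) f ` A \<subseteq> E} * n ^ (r - 2)"
      using exists_embedding_free_subset[OF finite_lessThan card_lessThan E finUA \<open>A \<noteq> {}\<close>, of r]
      unfolding J_def by blast
    have "?X \<le> real (card (cliques r {..<n} E'))
        + real (n ^ (r - 2)) * real (card {f \<in> J. (`) f ` A \<subseteq> E})"
      using of_nat_mono[OF del, where 'a = real] by (simp add: mult.commute)
    moreover have "0 \<le> ?X * ?Y / L" using L by simp
    ultimately have big: "2 * c * \<mu> \<le> real (card (cliques r {..<n} E'))" using pos by linarith
    \<comment> \<open>If \<open>?Y\<close> exceeded \<open>L\<close>, the subtracted product would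
      outweigh \<open>?X\<close>, and the functional could not be positive.\<close>
    have "?Y \<le> L"
    proof (rule ccontr)
      assume "\<not> ?Y \<le> L"
      then have "?X * 1 \<le> ?X * (?Y / L)" using L by (intro mult_left_mono) auto
      moreover have "0 < 2 * c * \<mu>" using c \<mu> by simp
      moreover have "0 \<le> real (n ^ (r - 2)) * real (card {f \<in> J. (`) f ` A \<subseteq> E})" by simp
      ultimately show False using pos by simp
    qed
    moreover have "card (cliques u {..<n} E') \<le> card (cliques u {..<n} E)"
      using E' by (intro card_mono finite_cliques cliques_mono) auto
    ultimately have "real (card (cliques u {..<n} E')) \<le> L" by simp
    moreover have "E' \<subseteq> [{..<n}]\<^bsup>2\<^esup>" using E E'(1) by (rule order_trans[rotated])
    moreover have "(2 * c * c ^ ?C) * real n powr (real r - a * real ?C)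
        \<le> real (card (cliques r {..<n} E'))"
      using big by (simp only: \<mu>_def mult.assoc)
    ultimately show ?thesis using E'(2) unfolding L_def by (intro exI[of _ E']) simp
  qed
  have "0 < 2 * c * c ^ ?C" using c by simp
  with K show ?thesis using main
    by (intro exI[of _ K] conjI exI[of _ "2 * c * c ^ ?C"]) simp_all
qed

section \<open>Excluding copies in the padded graph\<close>

text \<open>Here \<open>w1\<close>, \<open>e1\<close> count the part of \<open>F\<close> in the host
  and \<open>w2\<close>, \<open>e2\<close> the part in the padding. The balance equation and
  \<open>e1\<close> force \<open>w2 - 2 \<le> a * (e2 - (r choose 2))\<close>, whereas the sparsity
  of the padding bounds the right side by \<open>w2 - r\<close>, and \<open>r > 2\<close>.\<close>

lemma dense_part_contradiction:
  fixes a :: real and r u v e w1 w2 e1 e2 :: nat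
  assumes "2 \<le> u" "u < r" and a: "0 < a" "a * (real r - 1) \<le> 2"
    and balance: "a * (real e - real (r choose 2)) = real v - 2"
    and "w1 + w2 \<le> v" "e \<le> e1 + e2" "2 \<le> w2"
    and e2: "2 * e2 \<le> (u - 1) * w2" and e1: "a * real e1 \<le> real w1"
  shows False
proof -
  let ?C = "real r * (real r - 1) / 2"
  have "a * real e \<le> a * (real e1 + real e2)" using assms by (intro mult_left_mono) auto
  then have 1: "real w2 - 2 \<le> a * (real e2 - ?C)"
    using balance e1 \<open>w1 + w2 \<le> v\<close> by (simp add: real_choose_two algebra_simps)
  \<comment> \<open>Signs matter: \<open>2 \<le> w2\<close> leads to \<open>r \<le> w2\<close>, so
    that \<open>a * (r - 1) \<le> 2\<close> can be multiplied by \<open>w2 - r\<close>.\<close>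
  have "0 \<le> a * (real e2 - ?C)" using 1 \<open>2 \<le> w2\<close> by simp
  then have 2: "0 \<le> real e2 - ?C" using a by (simp add: zero_le_mult_iff)
  have "(u - 1) * w2 \<le> (r - 1) * w2" using assms by (intro mult_le_mono1) auto
  then have "2 * e2 \<le> (r - 1) * w2" using e2 by linarith
  then have "2 * real e2 \<le> (real r - 1) * real w2"
    using \<open>u < r\<close> of_nat_mono[of "2 * e2" "(r - 1) * w2", where 'a = real] by (simp add: of_nat_diff)
  then have 3: "real e2 - ?C \<le> (real r - 1) * (real w2 - real r) / 2"
    by (simp add: field_simps)
  then have "0 \<le> (real r - 1) * (real w2 - real r) / 2" using 2 by linarith
  then have 4: "0 \<le> real w2 - real r" using assms by (simp add: zero_le_mult_iff)
  have "a * (real e2 - ?C) \<le> a * ((real r - 1) * (real w2 - real r) / 2)"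
    using 3 a by (intro mult_left_mono) auto
  also have "\<dots> = a * (real r - 1) * ((real w2 - real r) / 2)" by simp
  also have "\<dots> \<le> 2 * ((real w2 - real r) / 2)" using a 4 by (intro mult_right_mono) auto
  finally show False using 1 assms by simp
qed

text \<open>Every edge of \<open>A\<close> lands on one side. The host side obeys the density bound
  \<open>sparse\<close>, the padding side obeys \<open>dens\<close>, and the two together contradict
  the edge count of \<open>A\<close>.\<close>

lemma no_edge_embedding_disjoint_union:
  fixes A :: "'a set set" and X Y :: "'b set" and a :: real
  assumes ur: "2 \<le> u" "u < r" and W: "finite W" "card W = v"
    and A: "A \<subseteq> [W]\<^bsup>2\<^esup>" "card A = e"
    and a: "0 < a" "a * (real r - 1) \<le> 2" "a * (real e - real (r choose 2)) = real v - 2"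
    and sparse: "\<And>B U. B \<subseteq> A \<Longrightarrow> B \<noteq> {} \<Longrightarrow> U \<subseteq> W \<Longrightarrow> B \<subseteq> [U]\<^bsup>2\<^esup> \<Longrightarrow> a * real (card B) \<le> real (card U)"
    and E: "E \<subseteq> [X]\<^bsup>2\<^esup>" "\<not> edge_embedding f A E" and P: "P \<subseteq> [Y]\<^bsup>2\<^esup>" "X \<inter> Y = {}"
    and dens: "\<And>T. finite T \<Longrightarrow> 2 * card {e \<in> P. e \<subseteq> T} \<le> (u - 1) * card T"
  shows "\<not> edge_embedding f A (E \<union> P)"
proof
  assume f: "edge_embedding f A (E \<union> P)"
  define W1 where "W1 = {x \<in> \<Union>A. f x \<in> X}"
  define W2 where "W2 = {x \<in> \<Union>A. f x \<in> Y}"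
  define A1 where "A1 = {e \<in> A. f ` e \<in> E}"
  define A2 where "A2 = {e \<in> A. f ` e \<in> P}"
  have inj: "inj_on f (\<Union>A)" using f by (simp add: edge_embedding_def)
  have UA: "\<Union>A \<subseteq> W" using A by (auto simp: nsets_def)
  have Ws: "W1 \<subseteq> W" "W2 \<subseteq> W" "W1 \<inter> W2 = {}" using UA P by (auto simp: W1_def W2_def)
  then have finW: "finite W1" "finite W2" using W by (auto intro: finite_subset)
  have finA: "finite A" using A W by (auto intro: finite_subset simp: finite_imp_finite_nsets)
  have "card W1 + card W2 = card (W1 \<union> W2)" using Ws finW by (simp add: card_Un_disjoint)
  also have "\<dots> \<le> v" using W Ws card_mono[of W "W1 \<union> W2"] by simp
  finally have w: "card W1 + card W2 \<le> v" .
  have "A = A1 \<union> A2" using f by (auto simp: A1_def A2_def edge_embedding_def)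
  then have e: "e \<le> card A1 + card A2" using A(2) card_Un_le by blast
  have sub1: "d \<subseteq> W1" if "d \<in> A1" for d
    using that E by (auto simp: A1_def W1_def nsets_def)
  have sub2: "d \<subseteq> W2" if "d \<in> A2" for d
    using that P by (auto simp: A2_def W2_def nsets_def)
  have e1: "a * real (card A1) \<le> real (card W1)"
  proof (cases "A1 = {}")
    case False
    have "A1 \<subseteq> [W1]\<^bsup>2\<^esup>" using sub1 A by (auto simp: nsets_def A1_def)
    then show ?thesis using sparse[of A1 W1] False Ws by (auto simp: A1_def)
  qed simp
  \<comment> \<open>Otherwise \<open>f\<close> would embed \<open>A\<close> into \<open>E\<close>
    alone. One edge in the padding gives \<open>2 \<le> card W2\<close>.\<close>
  have "A2 \<noteq> {}"
  proof
    assume "A2 = {}"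
    then have "A = A1" using \<open>A = A1 \<union> A2\<close> by simp
    then have "\<forall>d\<in>A. f ` d \<in> E" unfolding A1_def by blast
    then show False using inj E(2) by (simp add: edge_embedding_def)
  qed
  then obtain d where d: "d \<in> A2" by auto
  then have "card d = 2" using A by (auto simp: A2_def nsets_def)
  then have w2: "2 \<le> card W2" using card_mono[OF finW(2) sub2[OF d]] by simp
  have "inj_on ((`) f) A"
    using inj by (intro inj_onI) (metis Union_upper inj_on_image_eq_iff)
  then have "inj_on ((`) f) A2" by (rule inj_on_subset) (simp add: A2_def)
  then have "card A2 = card ((`) f ` A2)" by (simp add: card_image)
  also have "\<dots> \<le> card {e \<in> P. e \<subseteq> f ` W2}"
  proof (rule card_mono)
    show "finite {e \<in> P. e \<subseteq> f ` W2}"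
      by (rule finite_subset[of _ "Pow (f ` W2)"]) (use finW in auto)
    show "(`) f ` A2 \<subseteq> {e \<in> P. e \<subseteq> f ` W2}"
      using sub2 by (auto simp: A2_def)
  qed
  finally have "2 * card A2 \<le> (u - 1) * card (f ` W2)"
    using dens[of "f ` W2"] finW by simp
  also have "card (f ` W2) = card W2"
    using inj by (intro card_image) (auto simp: W2_def intro: inj_on_subset)
  finally have e2: "2 * card A2 \<le> (u - 1) * card W2" .
  show False
    using dense_part_contradiction[OF ur a(1,2,3) w e w2 e2 e1] .
qed

lemma graph_free_if_no_edge_embedding:
  assumes "simple_graph F" "\<And>f. \<not> edge_embedding f (edges F) (edges G)"
  shows "graph_free F G"
proof -
  have False if "H \<in> copies F G" for H
  proof -
    from that obtain f where f: "bij_betw f (verts F) (verts H)" "(\<lambda>e. f ` e) ` edges F = edges H"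
      and H: "edges H \<subseteq> edges G"
      by (auto simp: copies_def isomorphic_def subgraph_def)
    have "\<Union>(edges F) \<subseteq> verts F" using assms(1) by (auto simp: simple_graph_def nsets_def)
    then have "inj_on f (\<Union>(edges F))" using f(1) by (auto simp: bij_betw_def intro: inj_on_subset)
    moreover have "\<forall>e\<in>edges F. f ` e \<in> edges G" using f(2) H by auto
    ultimately show False using assms(2) by (auto simp: edge_embedding_def)
  qed
  then show ?thesis by (auto simp: graph_free_def)
qed

section \<open>Exponents and the final count\<close>

text \<open>Ensures that the density maximum in the hypothesis really bounds the density of each
  subgraph.\<close>

lemma finite_subgraphs:
  assumes "simple_graph F"
  shows "finite {H. subgraph H F}"
proof (rule finite_subset)
  show "{H. subgraph H F} \<subseteq> (\<lambda>(V, E). UGraph V E) ` (Pow (verts F) \<times> Pow (edges F))"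
  proof
    fix H assume "H \<in> {H. subgraph H F}"
    then have "(verts H, edges H) \<in> Pow (verts F) \<times> Pow (edges F)" by (simp add: subgraph_def)
    then show "H \<in> (\<lambda>(V, E). UGraph V E) ` (Pow (verts F) \<times> Pow (edges F))"
      by (intro image_eqI[of _ _ "(verts H, edges H)"]) auto
  qed
  have "finite (edges F)"
    using assms by (auto simp: simple_graph_def finite_imp_finite_nsets intro: finite_subset)
  then show "finite ((\<lambda>(V, E). UGraph V E) ` (Pow (verts F) \<times> Pow (edges F)))"
    using assms by (auto simp: simple_graph_def)
qed

theorem theorem1p5:
  fixes r u :: nat and F :: "'a ugraph"
  assumes "2 \<le> u" and "u < r"
    and "simple_graph F"
    and "num_verts F > 2"
    and "real (num_edges F)
           > (real r - 1) / 2 * real (num_verts F) + real (r choose 2) - (real r - 1)"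
    and "Max {2 * real (num_edges F\<^sub>0) / real (num_verts F\<^sub>0) | F\<^sub>0.
                subgraph F\<^sub>0 F \<and> num_edges F\<^sub>0 > 0}
           < (2 * real (num_edges F) - real r * (real r - 1)) / (real (num_verts F) - 2)"
  shows "\<exists>C::real. C > 0 \<and> (\<forall>\<^sub>F t in sequentially.
    real (ex_u u t (complete_graph r) F) \<ge> C * real t powr
      ((real r * real (num_edges F) - real (r choose 2) * real (num_verts F)
          - real r * real (r choose 2) + 2 * real (r choose 2))
       / (real u * real (num_edges F) - real (u choose 2) * real (num_verts F)
          - real u * real (r choose 2) + 2 * real (u choose 2))))"
proof -
  define v where "v = num_verts F"
  define e where "e = num_edges F"
  define A where "A = edges F"
  define W where "W = verts F"
  define Q where "Q = real e - real (r choose 2)"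
  define a where "a = (real v - 2) / Q"
  \<comment> \<open>Up to constants, \<open>n powr \<beta> k\<close> is the expected number of
    \<open>k\<close>-cliques in the random host.\<close>
  define \<beta> where "\<beta> = (\<lambda>k::nat. real k - a * real (k choose 2))"
  have W: "finite W" "card W = v" and A: "A \<subseteq> [W]\<^bsup>2\<^esup>" "card A = e"
    using assms(3) by (auto simp: W_def A_def v_def e_def num_verts_def num_edges_def simple_graph_def)
  have v: "2 < v" using assms(4) by (simp add: v_def)
  \<comment> \<open>The edge-count hypothesis in this form says \<open>a * (r - 1) < 2\<close>,
    which makes \<open>\<beta>\<close> positive from 1 up to \<open>r\<close>.\<close>
  have Q: "(real r - 1) / 2 * (real v - 2) < Q"
    using assms(5) by (simp add: Q_def v_def e_def field_simps)
  moreover have "0 \<le> (real r - 1) / 2 * (real v - 2)" using v assms(2) by simp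
  ultimately have Q0: "0 < Q" by linarith
  have a0: "0 < a" using Q0 v by (simp add: a_def)
  have aQ: "a * Q = real v - 2" using Q0 by (simp add: a_def)
  have ar: "a * (real r - 1) < 2"
    using Q Q0 by (simp add: a_def field_simps)
  have Ce: "(r choose 2) < e" using Q0 by (simp add: Q_def)

  \<comment> \<open>The graph on \<open>U\<close> with edges \<open>B\<close> competes in the
    density maximum, whose upper bound in the hypothesis is \<open>2 / a\<close>.\<close>
  have sparse: "a * real (card B) \<le> real (card U)"
    if B: "B \<subseteq> A" "B \<noteq> {}" "U \<subseteq> W" "B \<subseteq> [U]\<^bsup>2\<^esup>" for B U
  proof -
    let ?H = "UGraph U B"
    let ?M = "{2 * real (num_edges F\<^sub>0) / real (num_verts F\<^sub>0) | F\<^sub>0.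
                subgraph F\<^sub>0 F \<and> num_edges F\<^sub>0 > 0}"
    have finU: "finite U" using B W by (auto intro: finite_subset)
    then have finB: "finite B" using B by (auto simp: finite_imp_finite_nsets intro: finite_subset)
    have "subgraph ?H F"
      using B finU by (auto simp: subgraph_def simple_graph_def A_def W_def)
    moreover have "num_edges ?H > 0" using finB B by (simp add: num_edges_def card_gt_0_iff)
    ultimately have "2 * real (num_edges ?H) / real (num_verts ?H) \<in> ?M" by blast
    moreover have "finite ?M"
      by (rule finite_subset[OF _ finite_imageI[OF finite_subgraphs[OF assms(3)],
            of "\<lambda>H. 2 * real (num_edges H) / real (num_verts H)"]]) auto
    ultimately have "2 * real (num_edges ?H) / real (num_verts ?H) \<le> Max ?M" by (intro Max_ge)
    also have "\<dots> < 2 * Q / (real v - 2)"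
    proof -
      have "2 * Q = 2 * real (num_edges F) - real r * (real r - 1)"
        by (simp add: Q_def e_def real_choose_two)
      then show ?thesis using assms(6) by (simp add: v_def)
    qed
    finally have *: "2 * real (card B) / real (card U) < 2 * Q / (real v - 2)"
      by (simp add: num_edges_def num_verts_def)
    have "U \<noteq> {}" using B by (auto simp: nsets_def)
    then have "card U > 0" using finU by (simp add: card_gt_0_iff)
    then show ?thesis using * Q0 v by (simp add: a_def field_simps)
  qed

  have \<beta>_pos: "0 < \<beta> k" if "1 \<le> k" "k \<le> r" for k
  proof -
    have "a * (real k - 1) \<le> a * (real r - 1)" using a0 that by (intro mult_left_mono) auto
    then have "0 < real k / 2 * (2 - a * (real k - 1))" using ar that by (intro mult_pos_pos) auto
    also have "\<dots> = \<beta> k" by (simp add: \<beta>_def real_choose_two field_simps)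
    finally show ?thesis .
  qed
  \<comment> \<open>Since \<open>a * Q = v - 2\<close>, numerator and denominator of the claimed
    exponent are \<open>Q * \<beta> r\<close> and \<open>Q * \<beta> u\<close>.\<close>
  have num: "real k * real e - real (k choose 2) * real v - real k * real (r choose 2)
      + 2 * real (k choose 2) = Q * \<beta> k" for k
  proof -
    have "Q * \<beta> k = real k * Q - (a * Q) * real (k choose 2)" by (simp add: \<beta>_def algebra_simps)
    then show ?thesis unfolding aQ by (simp add: Q_def algebra_simps)
  qed
  have expo: "(real r * real (num_edges F) - real (r choose 2) * real (num_verts F)
          - real r * real (r choose 2) + 2 * real (r choose 2))
       / (real u * real (num_edges F) - real (u choose 2) * real (num_verts F)
          - real u * real (r choose 2) + 2 * real (u choose 2)) = \<beta> r / \<beta> u"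
    using num[of r] num[of u] Q0 by (simp add: v_def e_def)
  have \<beta>r: "0 < \<beta> r" and \<beta>u: "0 < \<beta> u" using \<beta>_pos assms by auto

  obtain K c where K: "0 < K" and c: "0 < c" and
    host: "\<And>n. n \<ge> r \<Longrightarrow> \<exists>E\<subseteq>[{..<n}]\<^bsup>2\<^esup>. (\<forall>f. \<not> edge_embedding f A E) \<and>
      c * real n powr \<beta> r \<le> real (card (cliques r {..<n} E)) \<and>
      real (card (cliques u {..<n} E)) \<le> K * real n powr \<beta> u"
    using exists_dense_embedding_free[of u r W v A e a] assms(1,2) W v A Ce aQ ar
    unfolding Q_def \<beta>_def by (auto simp: less_imp_le)

  have bound: "c / 2 powr \<beta> r / K powr (\<beta> r / \<beta> u) * real t powr (\<beta> r / \<beta> u)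
      \<le> real (ex_u u t (complete_graph r) F)"
    if t: "K * real r powr \<beta> u \<le> real t" for t
  proof -
    \<comment> \<open>The solution of \<open>K * x powr \<beta> u = t\<close>: a host on at most
      \<open>x\<close> vertices has at most \<open>t\<close> cliques of size \<open>u\<close>. The
      threshold on \<open>t\<close> gives \<open>r \<le> x\<close>, so rounding down keeps
      \<open>r \<le> n\<close> and loses at most a factor 2.\<close>
    define x where "x = (real t / K) powr (1 / \<beta> u)"
    define n where "n = nat \<lfloor>x\<rfloor>"
    have x\<beta>: "x powr \<beta> u = real t / K" using K \<beta>u by (simp add: x_def powr_powr)
    have "real r powr \<beta> u \<le> real t / K" using t K by (simp add: field_simps)
    then have "(real r powr \<beta> u) powr (1 / \<beta> u) \<le> x"
      unfolding x_def using \<beta>u by (intro powr_mono2) auto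
    then have rx: "real r \<le> x" using \<beta>u by (simp add: powr_powr)
    then have x3: "3 \<le> x" using assms by linarith
    have nr: "r \<le> n" using rx unfolding n_def by linarith
    have nx: "real n \<le> x" "x / 2 \<le> real n" using x3 unfolding n_def by linarith+
    obtain E where E: "E \<subseteq> [{..<n}]\<^bsup>2\<^esup>" and noE: "\<And>f. \<not> edge_embedding f A E"
      and Er: "c * real n powr \<beta> r \<le> real (card (cliques r {..<n} E))"
      and Eu: "real (card (cliques u {..<n} E)) \<le> K * real n powr \<beta> u"
      using host[OF nr] by blast
    have "K * real n powr \<beta> u \<le> K * x powr \<beta> u"
      using nx \<beta>u K by (intro mult_left_mono powr_mono2) auto
    then have Yt: "card (cliques u {..<n} E) \<le> t" using Eu x\<beta> K by simp
    \<comment> \<open>By \<open>Yt\<close> the subtraction is not truncated, so the padding brings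
      the count to exactly \<open>t\<close>.\<close>
    obtain N P where P: "P \<subseteq> [{n..<n + N}]\<^bsup>2\<^esup>"
      and Pu: "card (cliques u {n..<n + N} P) = t - card (cliques u {..<n} E)"
      and dens: "\<And>T. finite T \<Longrightarrow> 2 * card {e \<in> P. e \<subseteq> T} \<le> (u - 1) * card T"
      using exists_disjoint_cliques[OF assms(1), of n "t - card (cliques u {..<n} E)"] by blast
    define G where "G = UGraph ({..<n} \<union> {n..<n + N}) (E \<union> P)"
    have disj: "{..<n} \<inter> {n..<n + N} = {}" by auto
    have G: "simple_graph G"
      using E P nsets_mono[of "{..<n}" "{..<n} \<union> {n..<n + N}" 2]
        nsets_mono[of "{n..<n + N}" "{..<n} \<union> {n..<n + N}" 2]
      by (auto simp: G_def simple_graph_def)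
    have "\<not> edge_embedding f A (E \<union> P)" for f
      by (rule no_edge_embedding_disjoint_union[OF assms(1,2) W A a0 less_imp_le[OF ar]
            aQ[unfolded Q_def] sparse E noE P disj dens])
    then have free: "graph_free F G"
      using assms(3) by (intro graph_free_if_no_edge_embedding) (auto simp: G_def A_def)
    have "card (copies (complete_graph u) G) = card (cliques u ({..<n} \<union> {n..<n + N}) (E \<union> P))"
      by (simp add: G_def card_copies_complete_graph)
    also have "\<dots> = card (cliques u {..<n} E) + card (cliques u {n..<n + N} P)"
      using card_cliques_disjoint_union[OF assms(1) disj E P] by simp
    also have "\<dots> = t" using Pu Yt by simp
    finally have "card (copies (complete_graph r) G) \<le> ex_u u t (complete_graph r) F"
      using ex_u_ge[of u r G F t] G free assms by simp
    \<comment> \<open>Padding cannot destroy \<open>r\<close>-cliques, so the lower bound for the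
      host carries over.\<close>
    moreover have "card (cliques r {..<n} E) \<le> card (cliques r (verts G) (edges G))"
      by (intro card_mono finite_cliques cliques_mono) (auto simp: G_def)
    ultimately have "card (cliques r {..<n} E) \<le> ex_u u t (complete_graph r) F"
      by (simp add: G_def card_copies_complete_graph)
    then have "c * real n powr \<beta> r \<le> real (ex_u u t (complete_graph r) F)" using Er by linarith
    moreover have "c * (x / 2) powr \<beta> r \<le> c * real n powr \<beta> r"
      using nx x3 c \<beta>r by (intro mult_left_mono powr_mono2) auto
    moreover have "c * (x / 2) powr \<beta> r
        = c / 2 powr \<beta> r / K powr (\<beta> r / \<beta> u) * real t powr (\<beta> r / \<beta> u)"
      using x3 K by (simp add: x_def powr_divide powr_mult powr_powr)
    ultimately show ?thesis by linarith
  qed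
  have "\<forall>\<^sub>F t in sequentially. K * real r powr \<beta> u \<le> real t"
    by (rule eventually_sequentiallyI[of "nat \<lceil>K * real r powr \<beta> u\<rceil>"]) linarith
  then have "\<forall>\<^sub>F t in sequentially. c / 2 powr \<beta> r / K powr (\<beta> r / \<beta> u) * real t powr (\<beta> r / \<beta> u)
      \<le> real (ex_u u t (complete_graph r) F)"
    by (rule eventually_mono) (rule bound)
  moreover have "0 < c / 2 powr \<beta> r / K powr (\<beta> r / \<beta> u)" using c K by simp
  ultimately show ?thesis unfolding expo by blast
qed

end
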